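(* Assume that each prosumer utility $u^i_j$ and each generator cost $c^i_j$ satisfies the assumptions stated in the context, and that both the benchmark dispatch problem (B) and the aggregation dispatch problem (A) defined in the context are feasible. Let $\mathcal{W}_A^*$ be the optimal value of (A) and $\mathcal{W}_B^*$ the optimal value of (B). Then $$\mathcal{W}_A^*=\mathcal{W}_B^*.$$ Further, the optimal $\mathbf{x}^*,\mathbf{d}^*,\mathbf{y}^*$ solving (A) (with the convention that for each prosumer at most one of ${x^i_j}^*$, ${d^i_j}^*$ is nonzero) are the same as those solving (B), where for (B) the vectors $\mathbf{x}^*,\mathbf{d}^*$ are obtained from the optimal $(\mathbf{x}-\mathbf{d})^*$ by ${x^i_j}^*=[(x^i_j-d^i_j)^*]^+$ and ${d^i_j}^*=[-(x^i_j-d^i_j)^*]^+$.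
   Context: Notation: $[n]=\{1,\dots,n\}$ and $[a]^+=\max\{a,0\}$. Network: there are $n$ nodes. Node $i$ has $N_i$ prosumers and $G_i$ generators. $\mathbf{B}$ is a real $m\times n$ matrix (the line-to-node incidence matrix of the power network) and $\mathbf{f}\in\mathbb{R}^m$ is the vector of line capacities. Prosumers: prosumer $j$ at node $i$ has capacity $C^i_j\ge 0$ and utility $u^i_j:[0,Z]\to\mathbb{R}$, where $Z>C^i_j$ for all $i,j$. Each $u^i_j$ is increasing, strictly concave and differentiable (continuous on $[0,Z]$, differentiable on $(0,Z]$, one-sided at $Z$), with $\frac{\partial u^i_j(z)}{\partial z}\to\infty$ as $z\to 0$ and $\frac{\partial u^i_j(z)}{\partial z}\to 0$ as $z\to Z$. The variable $x^i_j$ is energy sold and $d^i_j$ is energy bought. Generators: generator $j$ at node $i$ produces $y^i_j\in[\underline{y}^i_j,\overline{y}^i_j]$ with $\underline{y}^i_j<\overline{y}^i_j$, at cost $c^i_j(y^i_j)$. Each $c^i_j:[\underline{y}^i_j,\overline{y}^i_j]\to\mathbb{R}$ is increasing, strictly convex and differentiable (continuous on the closed interval, differentiable on $[\underline{y}^i_j,\overline{y}^i_j)$, one-sided at the left endpoint), with $\frac{\partial c^i_j(y)}{\partial y}\to 0$ as $y\to\underline{y}^i_j$ and $\to\infty$ as $y\to\overline{y}^i_j$. Write $X^i=\sum_{j\in[N_i]}x^i_j$, $D^i=\sum_{j\in[N_i]}d^i_j$, $Y^i=\sum_{j\in[G_i]}y^i_j$. The network constraints on $\mathbf{h}\in\mathbb{R}^n$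 are $$\mathbf{h}=\mathbf{D}-\mathbf{Y}-\mathbf{X},\qquad \mathbf{1}^T\mathbf{h}=0,\qquad \mathbf{B}\mathbf{h}\le\mathbf{f}.$$ The social welfare in both models has the same expression, $$\mathcal{W}=\sum_{i\in[n]}\Big(\sum_{j\in[N_i]}u^i_j(d^i_j+C^i_j-x^i_j)-\sum_{j\in[G_i]}c^i_j(y^i_j)\Big).$$ Problem (B) (direct participation benchmark): maximize $\mathcal{W}_B(\mathbf{h},\mathbf{x}-\mathbf{d},\mathbf{y}):=\mathcal{W}$ over $\mathbf{h}$, the net sales $\mathbf{x}-\mathbf{d}$ (each $x^i_j-d^i_j$ being a single decision variable) and $\mathbf{y}$, subject to the network constraints and $C^i_j-Z\le x^i_j-d^i_j\le C^i_j$, $\underline{y}^i_j\le y^i_j\le\overline{y}^i_j$ for all $i,j$. Problem (A) (aggregation model): maximize $\mathcal{W}_A(\mathbf{h},\mathbf{x},\mathbf{d},\mathbf{y}):=\mathcal{W}$ over $\mathbf{h},\mathbf{x},\mathbf{d},\mathbf{y}$ subject to the network constraints and $0\le x^i_j\le C^i_j$, $0\le d^i_j\le Z-C^i_j+x^i_j$, $\underline{y}^i_j\le y^i_j\le\overline{y}^i_j$ for all $i,j$. *)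

theory Defs
  imports "HOL-Analysis.Analysis"
begin

definition strictly_convex_on :: "real set \<Rightarrow> (real \<Rightarrow> real) \<Rightarrow> bool" where
  "strictly_convex_on S f \<longleftrightarrow> convex S \<and>
     (\<forall>a\<in>S. \<forall>b\<in>S. \<forall>t\<in>{0<..<1}. a \<noteq> b \<longrightarrow>
        f ((1 - t) * a + t * b) < (1 - t) * f a + t * f b)"

definition strictly_concave_on :: "real set \<Rightarrow> (real \<Rightarrow> real) \<Rightarrow> bool" where
  "strictly_concave_on S f \<longleftrightarrow> strictly_convex_on S (\<lambda>z. - f z)"

(* Nodes and lines are the elements of the finite types 'n and 'm.  Node i has prosumers
   1, ..., prosumers M i and generators 1, ..., generators M i; the doubly indexed data and
   variables are functions of type 'n => nat => real of which only the values at these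
   indices matter. *)
record ('n, 'm) market =
  prosumers :: "'n \<Rightarrow> nat"
  generators :: "'n \<Rightarrow> nat"
  incidence :: "real ^ 'n ^ 'm"
  line_capacity :: "real ^ 'm"
  max_consumption :: real
  prosumer_capacity :: "'n \<Rightarrow> nat \<Rightarrow> real"
  utility :: "'n \<Rightarrow> nat \<Rightarrow> real \<Rightarrow> real"
  y_min :: "'n \<Rightarrow> nat \<Rightarrow> real"
  y_max :: "'n \<Rightarrow> nat \<Rightarrow> real"
  cost :: "'n \<Rightarrow> nat \<Rightarrow> real \<Rightarrow> real"

(* Near 0 from the right and near b from the left, deriv is evaluated only at interior points
   of {0..b}, where it is the derivative of u regardless of the values of u outside {0..b}. *)
definition utility_assms :: "real \<Rightarrow> (real \<Rightarrow> real) \<Rightarrow> bool" where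
  "utility_assms b u \<longleftrightarrow>
     mono_on {0..b} u \<and>
     strictly_concave_on {0..b} u \<and>
     continuous_on {0..b} u \<and>
     (\<forall>z\<in>{0<..b}. u differentiable (at z within {0..b})) \<and>
     filterlim (deriv u) at_top (at_right 0) \<and>
     (deriv u \<longlongrightarrow> 0) (at_left b)"

definition cost_assms :: "real \<Rightarrow> real \<Rightarrow> (real \<Rightarrow> real) \<Rightarrow> bool" where
  "cost_assms a b c \<longleftrightarrow>
     mono_on {a..b} c \<and>
     strictly_convex_on {a..b} c \<and>
     continuous_on {a..b} c \<and>
     (\<forall>y\<in>{a..<b}. c differentiable (at y within {a..b})) \<and>
     (deriv c \<longlongrightarrow> 0) (at_right a) \<and>
     filterlim (deriv c) at_top (at_left b)"

definition market_assms :: "('n::finite, 'm::finite) market \<Rightarrow> bool" where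
  "market_assms M \<longleftrightarrow>
     (\<forall>i. \<forall>j\<in>{1..prosumers M i}.
        0 \<le> prosumer_capacity M i j \<and> prosumer_capacity M i j < max_consumption M \<and>
        utility_assms (max_consumption M) (utility M i j)) \<and>
     (\<forall>i. \<forall>j\<in>{1..generators M i}.
        y_min M i j < y_max M i j \<and> cost_assms (y_min M i j) (y_max M i j) (cost M i j))"

definition flow_feasible :: "('n::finite, 'm::finite) market \<Rightarrow> real ^ 'n \<Rightarrow> bool" where
  "flow_feasible M h \<longleftrightarrow> (\<Sum>i\<in>UNIV. h $ i) = 0 \<and> incidence M *v h \<le> line_capacity M"

definition generation_feasible ::
    "('n::finite, 'm::finite) market \<Rightarrow> ('n \<Rightarrow> nat \<Rightarrow> real) \<Rightarrow> bool" where
  "generation_feasible M y \<longleftrightarrow>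
     (\<forall>i. \<forall>j\<in>{1..generators M i}. y_min M i j \<le> y i j \<and> y i j \<le> y_max M i j)"

definition feasible_A :: "('n::finite, 'm::finite) market \<Rightarrow>
    ((real ^ 'n) \<times> ('n \<Rightarrow> nat \<Rightarrow> real) \<times> ('n \<Rightarrow> nat \<Rightarrow> real) \<times> ('n \<Rightarrow> nat \<Rightarrow> real)) set" where
  "feasible_A M = {(h, x, d, y).
     (\<forall>i. h $ i = (\<Sum>j\<in>{1..prosumers M i}. d i j) - (\<Sum>j\<in>{1..generators M i}. y i j)
                 - (\<Sum>j\<in>{1..prosumers M i}. x i j)) \<and>
     flow_feasible M h \<and>
     (\<forall>i. \<forall>j\<in>{1..prosumers M i}.
        0 \<le> x i j \<and> x i j \<le> prosumer_capacity M i j \<and>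
        0 \<le> d i j \<and> d i j \<le> max_consumption M - prosumer_capacity M i j + x i j) \<and>
     generation_feasible M y}"

fun welfare_A :: "('n::finite, 'm::finite) market \<Rightarrow>
    (real ^ 'n) \<times> ('n \<Rightarrow> nat \<Rightarrow> real) \<times> ('n \<Rightarrow> nat \<Rightarrow> real) \<times> ('n \<Rightarrow> nat \<Rightarrow> real) \<Rightarrow> real" where
  "welfare_A M (h, x, d, y) = (\<Sum>i\<in>UNIV.
     (\<Sum>j\<in>{1..prosumers M i}. utility M i j (d i j + prosumer_capacity M i j - x i j)) -
     (\<Sum>j\<in>{1..generators M i}. cost M i j (y i j)))"

(* In (B) the single variable s i j is the net sale x i j - d i j, so that
   D - Y - X = - S - Y and d + C - x = C - s. *)
definition feasible_B :: "('n::finite, 'm::finite) market \<Rightarrow>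
    ((real ^ 'n) \<times> ('n \<Rightarrow> nat \<Rightarrow> real) \<times> ('n \<Rightarrow> nat \<Rightarrow> real)) set" where
  "feasible_B M = {(h, s, y).
     (\<forall>i. h $ i = - (\<Sum>j\<in>{1..prosumers M i}. s i j) - (\<Sum>j\<in>{1..generators M i}. y i j)) \<and>
     flow_feasible M h \<and>
     (\<forall>i. \<forall>j\<in>{1..prosumers M i}.
        prosumer_capacity M i j - max_consumption M \<le> s i j \<and> s i j \<le> prosumer_capacity M i j) \<and>
     generation_feasible M y}"

fun welfare_B :: "('n::finite, 'm::finite) market \<Rightarrow>
    (real ^ 'n) \<times> ('n \<Rightarrow> nat \<Rightarrow> real) \<times> ('n \<Rightarrow> nat \<Rightarrow> real) \<Rightarrow> real" where
  "welfare_B M (h, s, y) = (\<Sum>i\<in>UNIV.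
     (\<Sum>j\<in>{1..prosumers M i}. utility M i j (prosumer_capacity M i j - s i j)) -
     (\<Sum>j\<in>{1..generators M i}. cost M i j (y i j)))"

(* Sup of an empty or unbounded set of reals is an arbitrary value; these two are only
   meaningful when the maxima are attained. *)
definition opt_value_A :: "('n::finite, 'm::finite) market \<Rightarrow> real" where
  "opt_value_A M = (SUP p\<in>feasible_A M. welfare_A M p)"

definition opt_value_B :: "('n::finite, 'm::finite) market \<Rightarrow> real" where
  "opt_value_B M = (SUP p\<in>feasible_B M. welfare_B M p)"

(* Optimal for (A), under the convention that no prosumer both sells and buys. *)
definition dispatch_A :: "('n::finite, 'm::finite) market \<Rightarrow>
    ('n \<Rightarrow> nat \<Rightarrow> real) \<Rightarrow> ('n \<Rightarrow> nat \<Rightarrow> real) \<Rightarrow> ('n \<Rightarrow> nat \<Rightarrow> real) \<Rightarrow> bool" where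
  "dispatch_A M x d y \<longleftrightarrow>
     (\<exists>h. is_arg_max (welfare_A M) (\<lambda>p. p \<in> feasible_A M) (h, x, d, y)) \<and>
     (\<forall>i. \<forall>j\<in>{1..prosumers M i}. x i j = 0 \<or> d i j = 0)"

(* x and d recovered as positive and negative parts of optimal net sales for (B). *)
definition dispatch_B :: "('n::finite, 'm::finite) market \<Rightarrow>
    ('n \<Rightarrow> nat \<Rightarrow> real) \<Rightarrow> ('n \<Rightarrow> nat \<Rightarrow> real) \<Rightarrow> ('n \<Rightarrow> nat \<Rightarrow> real) \<Rightarrow> bool" where
  "dispatch_B M x d y \<longleftrightarrow>
     (\<exists>h s. is_arg_max (welfare_B M) (\<lambda>p. p \<in> feasible_B M) (h, s, y) \<and>
        (\<forall>i. \<forall>j\<in>{1..prosumers M i}. x i j = max (s i j) 0 \<and> d i j = max (- s i j) 0))"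

definition same_dispatch :: "('n::finite, 'm::finite) market \<Rightarrow>
    ('n \<Rightarrow> nat \<Rightarrow> real) \<Rightarrow> ('n \<Rightarrow> nat \<Rightarrow> real) \<Rightarrow> ('n \<Rightarrow> nat \<Rightarrow> real) \<Rightarrow>
    ('n \<Rightarrow> nat \<Rightarrow> real) \<Rightarrow> ('n \<Rightarrow> nat \<Rightarrow> real) \<Rightarrow> ('n \<Rightarrow> nat \<Rightarrow> real) \<Rightarrow> bool" where
  "same_dispatch M x d y x' d' y' \<longleftrightarrow>
     (\<forall>i. \<forall>j\<in>{1..prosumers M i}. x i j = x' i j \<and> d i j = d' i j) \<and>
     (\<forall>i. \<forall>j\<in>{1..generators M i}. y i j = y' i j)"

end

(* Only the net sale x - d enters the constraints of (B) and the welfare, so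
   (h, x, d, y) \<mapsto> (h, x - d, y) maps feasible points of (A) to feasible points of (B) with the
   same welfare, and splitting a net sale into its positive and negative part goes back.
   Hence the values agree and optima correspond.  An optimum of (B) exists by compactness, and
   its net sales and outputs are unique because the midpoint of two distinct ones would be
   strictly better. *)
theory Submission
  imports Defs
begin

declare welfare_A.simps [simp del] welfare_B.simps [simp del]

section \<open>Midpoint convexity and topology of doubly indexed families\<close>

text \<open>Strictness is needed only at \<open>t = 1/2\<close>. The equality case is separated out
  because the uniqueness argument ends with gaps that vanish.\<close>

lemma strictly_convex_on_midpoint:
  assumes "strictly_convex_on S f" "a \<in> S" "b \<in> S"
  shows "f ((a + b) / 2) \<le> (f a + f b) / 2"
    and "f ((a + b) / 2) = (f a + f b) / 2 \<Longrightarrow> a = b"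
proof -
  have strict: "f ((a + b) / 2) < (f a + f b) / 2" if "a \<noteq> b"
  proof -
    have "f ((1 - 1/2) * a + (1/2) * b) < (1 - 1/2) * f a + (1/2) * f b"
      using assms that unfolding strictly_convex_on_def
      by (metis divide_less_eq_1_pos divide_pos_pos greaterThanLessThan_iff one_less_numeral_iff
          semiring_norm(76) zero_less_numeral zero_less_one)
    thus ?thesis by (simp add: field_simps)
  qed
  show "f ((a + b) / 2) \<le> (f a + f b) / 2"
    using strict by (cases "a = b") auto
  show "f ((a + b) / 2) = (f a + f b) / 2 \<Longrightarrow> a = b"
    using strict by fastforce
qed

text \<open>This is Tychonoff's theorem: a function type carries the product topology over
  \<open>UNIV\<close>. It will be applied twice per variable, over nodes and over the indices at a
  node.\<close>

lemma compact_Pi_UNIV: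
  fixes K :: "'a \<Rightarrow> ('b::topological_space) set"
  assumes "\<And>i. compact (K i)"
  shows "compact {f. \<forall>i. f i \<in> K i}"
proof -
  have "compactin (product_topology (\<lambda>i. euclidean) UNIV) (PiE UNIV K)"
    using assms by (simp add: compactin_PiE)
  moreover have "PiE UNIV K = {f. \<forall>i. f i \<in> K i}" by auto
  ultimately show ?thesis by (simp add: euclidean_product_topology)
qed

lemma continuous_on_coordinate2:
  assumes "continuous_on S f"
  shows "continuous_on S (\<lambda>p. f p i j)"
  by (rule continuous_on_product_then_coordinatewise)
    (rule continuous_on_product_then_coordinatewise[OF assms])

section \<open>Closedness and midpoint stability of the network constraints\<close>

text \<open>Reading the matrix inequality row by row exhibits the constraints as one linear equation
  and finitely many linear inequalities.\<close>

lemma flow_feasible_iff: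
  "flow_feasible M h \<longleftrightarrow>
     (\<Sum>i\<in>UNIV. h $ i) = 0 \<and> (\<forall>k. (incidence M $ k) \<bullet> h \<le> line_capacity M $ k)"
  by (simp add: flow_feasible_def less_eq_vec_def matrix_vector_mul_component)

lemma closed_flow_feasible: "closed {h. flow_feasible M h}"
  unfolding flow_feasible_iff
  by (intro closed_Collect_conj closed_Collect_all closed_Collect_eq closed_Collect_le
      continuous_intros)

lemma flow_feasible_midpoint:
  assumes "flow_feasible M h" "flow_feasible M h'"
  shows "flow_feasible M ((1/2) *\<^sub>R (h + h'))"
proof -
  have "(\<Sum>i\<in>UNIV. ((1/2) *\<^sub>R (h + h')) $ i) = ((\<Sum>i\<in>UNIV. h $ i) + (\<Sum>i\<in>UNIV. h' $ i)) / 2"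
    by (simp add: sum.distrib add_divide_distrib flip: sum_divide_distrib)
  moreover have "(incidence M $ k) \<bullet> ((1/2) *\<^sub>R (h + h'))
      = ((incidence M $ k) \<bullet> h + (incidence M $ k) \<bullet> h') / 2" for k
    by (simp add: inner_add_right)
  moreover have "((incidence M $ k) \<bullet> h + (incidence M $ k) \<bullet> h') / 2 \<le> line_capacity M $ k" for k
  proof -
    have "(incidence M $ k) \<bullet> h \<le> line_capacity M $ k" "(incidence M $ k) \<bullet> h' \<le> line_capacity M $ k"
      using assms unfolding flow_feasible_iff by blast+
    thus ?thesis by simp
  qed
  ultimately show ?thesis using assms unfolding flow_feasible_iff by simp
qed

section \<open>Correspondence between (A) and (B)\<close>

text \<open>The upper bound on the net sale combines the upper bound on \<open>x\<close> with
  \<open>d \<ge> 0\<close>; the lower bound is the constraint on \<open>d\<close>,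
  rearranged.\<close>

lemma feasible_A_imp_feasible_B:
  assumes "(h, x, d, y) \<in> feasible_A M"
  shows "(h, \<lambda>i j. x i j - d i j, y) \<in> feasible_B M"
proof -
  have "prosumer_capacity M i j - max_consumption M \<le> x i j - d i j \<and>
      x i j - d i j \<le> prosumer_capacity M i j" if j: "j \<in> {1..prosumers M i}" for i j
  proof -
    have "x i j \<le> prosumer_capacity M i j" "0 \<le> d i j"
      "d i j \<le> max_consumption M - prosumer_capacity M i j + x i j"
      using assms j unfolding feasible_A_def by blast+
    thus ?thesis by simp
  qed
  thus ?thesis
    using assms unfolding feasible_A_def feasible_B_def by (simp add: sum_subtractf)
qed

text \<open>If \<open>s \<ge> 0\<close>, then \<open>d = 0\<close> and its upper bound holds because
  the capacity is below \<open>max_consumption M\<close>. If \<open>s < 0\<close>, then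
  \<open>x = 0\<close> is admissible because the capacity is nonnegative, and the bound on
  \<open>d = - s\<close> is the lower bound on \<open>s\<close>. The parts are prescribed only at
  used indices, as in \<open>dispatch_B\<close>.\<close>

lemma feasible_B_imp_feasible_A:
  assumes "market_assms M" "(h, s, y) \<in> feasible_B M"
    and parts: "\<And>i j. j \<in> {1..prosumers M i} \<Longrightarrow> x i j = max (s i j) 0 \<and> d i j = max (- s i j) 0"
  shows "(h, x, d, y) \<in> feasible_A M"
proof -
  have "(\<Sum>j\<in>{1..prosumers M i}. d i j) - (\<Sum>j\<in>{1..prosumers M i}. x i j)
      = - (\<Sum>j\<in>{1..prosumers M i}. s i j)" for i
    unfolding sum_subtractf[symmetric] sum_negf[symmetric]
    by (rule sum.cong) (use parts in auto)
  moreover have "0 \<le> x i j \<and> x i j \<le> prosumer_capacity M i j \<and>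
      0 \<le> d i j \<and> d i j \<le> max_consumption M - prosumer_capacity M i j + x i j"
    if j: "j \<in> {1..prosumers M i}" for i j
  proof -
    have "0 \<le> prosumer_capacity M i j" "prosumer_capacity M i j < max_consumption M"
      using assms(1) j unfolding market_assms_def by blast+
    moreover have "prosumer_capacity M i j - max_consumption M \<le> s i j"
      "s i j \<le> prosumer_capacity M i j"
      using assms(2) j unfolding feasible_B_def by blast+
    ultimately show ?thesis using parts[OF j] by auto
  qed
  ultimately show ?thesis
    using assms(2) unfolding feasible_A_def feasible_B_def
    by (auto simp: algebra_simps) (smt (verit))
qed

lemma welfare_B_prod:
  "welfare_B M (h, p) = (\<Sum>i\<in>UNIV.
     (\<Sum>j\<in>{1..prosumers M i}. utility M i j (prosumer_capacity M i j - fst p i j)) -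
     (\<Sum>j\<in>{1..generators M i}. cost M i j (snd p i j)))"
  by (cases p) (simp add: welfare_B.simps)

lemma welfare_A_eq_welfare_B:
  assumes "\<And>i j. j \<in> {1..prosumers M i} \<Longrightarrow> s i j = x i j - d i j"
  shows "welfare_A M (h, x, d, y) = welfare_B M (h, s, y)"
proof -
  have "d i j + prosumer_capacity M i j - x i j = prosumer_capacity M i j - s i j"
    if "j \<in> {1..prosumers M i}" for i j
    using assms[OF that] by simp
  thus ?thesis
    unfolding welfare_A.simps welfare_B.simps
    by (intro sum.cong arg_cong2[where f = "(-)"] refl) metis
qed

text \<open>Equal sets of attainable values give equal suprema at once and also let optimality pass
  between the problems.\<close>

lemma welfare_A_image_eq_welfare_B_image:
  assumes "market_assms M"
  shows "welfare_A M ` feasible_A M = welfare_B M ` feasible_B M"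
proof (intro set_eqI iffI)
  fix w assume "w \<in> welfare_A M ` feasible_A M"
  then obtain p where p: "p \<in> feasible_A M" "w = welfare_A M p" by blast
  obtain h x d y where p_eq: "p = (h, x, d, y)" by (cases p)
  have "w = welfare_B M (h, \<lambda>i j. x i j - d i j, y)"
    unfolding p(2) p_eq by (rule welfare_A_eq_welfare_B) simp
  thus "w \<in> welfare_B M ` feasible_B M"
    using feasible_A_imp_feasible_B p(1) unfolding p_eq by blast
next
  fix w assume "w \<in> welfare_B M ` feasible_B M"
  then obtain q where q: "q \<in> feasible_B M" "w = welfare_B M q" by blast
  obtain h s y where q_eq: "q = (h, s, y)" by (cases q)
  let ?x = "\<lambda>i j. max (s i j) 0" and ?d = "\<lambda>i j. max (- s i j) 0"
  have "(h, ?x, ?d, y) \<in> feasible_A M"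
    by (rule feasible_B_imp_feasible_A[OF assms q(1)[unfolded q_eq]]) auto
  moreover have "w = welfare_A M (h, ?x, ?d, y)"
    unfolding q(2) q_eq by (rule welfare_A_eq_welfare_B[symmetric]) auto
  ultimately show "w \<in> welfare_A M ` feasible_A M" by blast
qed

text \<open>Phrasing optimality through the set of attained values makes the equality of the two
  images applicable by rewriting.\<close>

lemma is_arg_max_iff:
  fixes f :: "'a \<Rightarrow> real"
  shows "is_arg_max f (\<lambda>p. p \<in> S) a \<longleftrightarrow> a \<in> S \<and> (\<forall>w\<in>f ` S. w \<le> f a)"
  by (auto simp: is_arg_max_def not_less)

text \<open>In (A) both \<open>x\<close> and \<open>d\<close> are nonnegative; when one of them is
  zero, they are exactly the positive and negative part of \<open>x - d\<close>. Optimality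
  transfers because corresponding points have equal welfare.\<close>

lemma dispatch_A_iff_dispatch_B:
  assumes "market_assms M"
  shows "dispatch_A M x d y \<longleftrightarrow> dispatch_B M x d y"
proof
  assume "dispatch_A M x d y"
  then obtain h where opt: "is_arg_max (welfare_A M) (\<lambda>p. p \<in> feasible_A M) (h, x, d, y)"
    and excl: "\<forall>i. \<forall>j\<in>{1..prosumers M i}. x i j = 0 \<or> d i j = 0"
    unfolding dispatch_A_def by blast
  have f: "(h, x, d, y) \<in> feasible_A M" using opt by (simp add: is_arg_max_def)
  let ?s = "\<lambda>i j. x i j - d i j"
  have "is_arg_max (welfare_B M) (\<lambda>p. p \<in> feasible_B M) (h, ?s, y)"
    using opt feasible_A_imp_feasible_B[OF f] welfare_A_eq_welfare_B[of M ?s x d h y]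
    unfolding is_arg_max_iff welfare_A_image_eq_welfare_B_image[OF assms] by simp
  moreover have "x i j = max (?s i j) 0 \<and> d i j = max (- ?s i j) 0"
    if j: "j \<in> {1..prosumers M i}" for i j
  proof -
    have "0 \<le> x i j" "0 \<le> d i j" using f j unfolding feasible_A_def by blast+
    thus ?thesis using excl j by fastforce
  qed
  ultimately show "dispatch_B M x d y" unfolding dispatch_B_def by blast
next
  assume "dispatch_B M x d y"
  then obtain h s where opt: "is_arg_max (welfare_B M) (\<lambda>p. p \<in> feasible_B M) (h, s, y)"
    and parts: "\<And>i j. j \<in> {1..prosumers M i} \<Longrightarrow> x i j = max (s i j) 0 \<and> d i j = max (- s i j) 0"
    unfolding dispatch_B_def by blast
  have "(h, x, d, y) \<in> feasible_A M"
    by (rule feasible_B_imp_feasible_A[OF assms _ parts]) (use opt in \<open>simp add: is_arg_max_def\<close>)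
  moreover have "welfare_A M (h, x, d, y) = welfare_B M (h, s, y)"
    by (rule welfare_A_eq_welfare_B) (use parts in auto)
  ultimately have "is_arg_max (welfare_A M) (\<lambda>p. p \<in> feasible_A M) (h, x, d, y)"
    using opt unfolding is_arg_max_iff welfare_A_image_eq_welfare_B_image[OF assms] by simp
  moreover have "\<forall>i. \<forall>j\<in>{1..prosumers M i}. x i j = 0 \<or> d i j = 0"
    using parts by fastforce
  ultimately show "dispatch_A M x d y" unfolding dispatch_A_def by blast
qed

section \<open>Uniqueness of optimal net sales and outputs\<close>

lemma feasible_B_midpoint:
  assumes "(h, s, y) \<in> feasible_B M" "(h', s', y') \<in> feasible_B M"
  shows "((1/2) *\<^sub>R (h + h'), \<lambda>i j. (s i j + s' i j) / 2, \<lambda>i j. (y i j + y' i j) / 2)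
    \<in> feasible_B M"
proof -
  have "flow_feasible M ((1/2) *\<^sub>R (h + h'))"
    using assms by (intro flow_feasible_midpoint) (auto simp: feasible_B_def)
  moreover have "((1/2) *\<^sub>R (h + h')) $ i = - (\<Sum>j\<in>{1..prosumers M i}. (s i j + s' i j) / 2)
      - (\<Sum>j\<in>{1..generators M i}. (y i j + y' i j) / 2)" for i
  proof -
    have "h $ i = - (\<Sum>j\<in>{1..prosumers M i}. s i j) - (\<Sum>j\<in>{1..generators M i}. y i j)"
      "h' $ i = - (\<Sum>j\<in>{1..prosumers M i}. s' i j) - (\<Sum>j\<in>{1..generators M i}. y' i j)"
      using assms unfolding feasible_B_def by blast+
    thus ?thesis
      by (simp add: sum.distrib add_divide_distrib diff_divide_distrib flip: sum_divide_distrib)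
  qed
  moreover have "prosumer_capacity M i j - max_consumption M \<le> (s i j + s' i j) / 2 \<and>
      (s i j + s' i j) / 2 \<le> prosumer_capacity M i j" if j: "j \<in> {1..prosumers M i}" for i j
  proof -
    have "prosumer_capacity M i j - max_consumption M \<le> s i j" "s i j \<le> prosumer_capacity M i j"
      "prosumer_capacity M i j - max_consumption M \<le> s' i j" "s' i j \<le> prosumer_capacity M i j"
      using assms j unfolding feasible_B_def by blast+
    thus ?thesis by simp
  qed
  moreover have "y_min M i j \<le> (y i j + y' i j) / 2 \<and> (y i j + y' i j) / 2 \<le> y_max M i j"
    if j: "j \<in> {1..generators M i}" for i j
  proof -
    have "y_min M i j \<le> y i j" "y i j \<le> y_max M i j"
      "y_min M i j \<le> y' i j" "y' i j \<le> y_max M i j"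
      using assms j unfolding feasible_B_def generation_feasible_def by blast+
    thus ?thesis by simp
  qed
  ultimately show ?thesis
    unfolding feasible_B_def generation_feasible_def by blast
qed

text \<open>The welfare gained by moving to the midpoint of two optima is a sum of nonnegative gaps,
  one per prosumer and generator. Optimality forces every gap to vanish, and strictness then
  identifies the coordinates.\<close>

lemma arg_max_B_unique:
  assumes M: "market_assms M"
    and opt: "is_arg_max (welfare_B M) (\<lambda>p. p \<in> feasible_B M) (h, s, y)"
    and opt': "is_arg_max (welfare_B M) (\<lambda>p. p \<in> feasible_B M) (h', s', y')"
  shows "\<forall>i. \<forall>j\<in>{1..prosumers M i}. s i j = s' i j"
    and "\<forall>i. \<forall>j\<in>{1..generators M i}. y i j = y' i j"
proof -
  have f: "(h, s, y) \<in> feasible_B M" and f': "(h', s', y') \<in> feasible_B M"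
    using opt opt' by (auto simp: is_arg_max_def)
  let ?h = "(1/2) *\<^sub>R (h + h')" and ?s = "\<lambda>i j. (s i j + s' i j) / 2"
    and ?y = "\<lambda>i j. (y i j + y' i j) / 2"
  \<comment> \<open>\<open>gu\<close> and \<open>gc\<close> are the contributions of one prosumer
    and of one generator to the gain at the midpoint. Cost enters welfare negatively, hence the
    reversed order of the difference in \<open>gc\<close>.\<close>
  define gu where "gu = (\<lambda>i j. utility M i j (prosumer_capacity M i j - ?s i j)
     - (utility M i j (prosumer_capacity M i j - s i j)
        + utility M i j (prosumer_capacity M i j - s' i j)) / 2)"
  define gc where "gc = (\<lambda>i j. (cost M i j (y i j) + cost M i j (y' i j)) / 2
     - cost M i j (?y i j))"
  have gu: "0 \<le> gu i j" "gu i j = 0 \<Longrightarrow> s i j = s' i j" if j: "j \<in> {1..prosumers M i}" for i j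
  proof -
    let ?C = "prosumer_capacity M i j"
    have conv: "strictly_convex_on {0..max_consumption M} (\<lambda>z. - utility M i j z)"
      using M j unfolding market_assms_def utility_assms_def strictly_concave_on_def by blast
    have "?C - max_consumption M \<le> s i j" "s i j \<le> ?C"
      "?C - max_consumption M \<le> s' i j" "s' i j \<le> ?C"
      using f f' j unfolding feasible_B_def by blast+
    hence mem: "?C - s i j \<in> {0..max_consumption M}" "?C - s' i j \<in> {0..max_consumption M}"
      by auto
    have mid: "((?C - s i j) + (?C - s' i j)) / 2 = ?C - ?s i j" by (simp add: field_simps)
    note * = strictly_convex_on_midpoint[OF conv mem, unfolded mid]
    show "0 \<le> gu i j" using *(1) unfolding gu_def by (simp add: field_simps)
    show "s i j = s' i j" if "gu i j = 0"
      using *(2) that unfolding gu_def by (simp add: field_simps)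
  qed
  have gc: "0 \<le> gc i j" "gc i j = 0 \<Longrightarrow> y i j = y' i j" if j: "j \<in> {1..generators M i}" for i j
  proof -
    have conv: "strictly_convex_on {y_min M i j..y_max M i j} (cost M i j)"
      using M j unfolding market_assms_def cost_assms_def by blast
    have "y_min M i j \<le> y i j" "y i j \<le> y_max M i j"
      "y_min M i j \<le> y' i j" "y' i j \<le> y_max M i j"
      using f f' j unfolding feasible_B_def generation_feasible_def by blast+
    hence mem: "y i j \<in> {y_min M i j..y_max M i j}" "y' i j \<in> {y_min M i j..y_max M i j}"
      by auto
    note * = strictly_convex_on_midpoint[OF conv mem]
    show "0 \<le> gc i j" using *(1) unfolding gc_def by simp
    show "y i j = y' i j" if "gc i j = 0" using *(2) that unfolding gc_def by simp
  qed
  have "(\<Sum>i\<in>UNIV. (\<Sum>j\<in>{1..prosumers M i}. gu i j) + (\<Sum>j\<in>{1..generators M i}. gc i j))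
      = welfare_B M (?h, ?s, ?y) - (welfare_B M (h, s, y) + welfare_B M (h', s', y')) / 2"
    unfolding gu_def gc_def welfare_B.simps
    by (simp add: sum.distrib sum_subtractf sum_divide_distrib add_divide_distrib
        diff_divide_distrib)
  \<comment> \<open>Both points attain the maximum, so the average of their values is the maximum
    and bounds the value at the feasible midpoint.\<close>
  also have "\<dots> \<le> 0"
    using opt opt' feasible_B_midpoint[OF f f'] unfolding is_arg_max_def by fastforce
  finally have le: "(\<Sum>i\<in>UNIV. (\<Sum>j\<in>{1..prosumers M i}. gu i j)
      + (\<Sum>j\<in>{1..generators M i}. gc i j)) \<le> 0" .
  have nn: "0 \<le> (\<Sum>j\<in>{1..prosumers M i}. gu i j)" "0 \<le> (\<Sum>j\<in>{1..generators M i}. gc i j)" for i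
    using gu(1) gc(1) by (auto intro!: sum_nonneg)
  have "(\<Sum>i\<in>UNIV. (\<Sum>j\<in>{1..prosumers M i}. gu i j) + (\<Sum>j\<in>{1..generators M i}. gc i j)) = 0"
    by (rule antisym[OF le sum_nonneg]) (use nn in \<open>simp add: add_nonneg_nonneg\<close>)
  hence "(\<Sum>j\<in>{1..prosumers M i}. gu i j) + (\<Sum>j\<in>{1..generators M i}. gc i j) = 0" for i
    using nn by (subst (asm) sum_nonneg_eq_0_iff) (auto intro: add_nonneg_nonneg)
  hence z: "(\<Sum>j\<in>{1..prosumers M i}. gu i j) = 0" "(\<Sum>j\<in>{1..generators M i}. gc i j) = 0" for i
    using nn by (auto simp: add_nonneg_eq_0_iff)
  show "\<forall>i. \<forall>j\<in>{1..prosumers M i}. s i j = s' i j"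
    using z(1) gu by (subst (asm) sum_nonneg_eq_0_iff) auto
  show "\<forall>i. \<forall>j\<in>{1..generators M i}. y i j = y' i j"
    using z(2) gc by (subst (asm) sum_nonneg_eq_0_iff) auto
qed

section \<open>Existence of an optimum of (B)\<close>

text \<open>The flow \<open>h\<close> is eliminated through the balance equation, and a continuous
  function on a compact set of pairs \<open>(s, y)\<close> attains its maximum.\<close>

lemma arg_max_B_exists:
  fixes M :: "('n::finite, 'm::finite) market"
  assumes M: "market_assms M" and ne: "feasible_B M \<noteq> {}"
  shows "\<exists>p. is_arg_max (welfare_B M) (\<lambda>p. p \<in> feasible_B M) p"
proof -
  (* Coordinates at unused indices are pinned to 0, which makes the domain compact. *)
  define Ks where "Ks i j = (if j \<in> {1..prosumers M i}
      then {prosumer_capacity M i j - max_consumption M..prosumer_capacity M i j} else {0})" for i j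
  define Ky where "Ky i j = (if j \<in> {1..generators M i}
      then {y_min M i j..y_max M i j} else {0})" for i j
  \<comment> \<open>\<open>H p\<close> is the only flow compatible with the net sales and outputs in
    \<open>p\<close>.\<close>
  define H :: "('n \<Rightarrow> nat \<Rightarrow> real) \<times> ('n \<Rightarrow> nat \<Rightarrow> real) \<Rightarrow> real ^ 'n" where
    "H p = (\<chi> i. - (\<Sum>j\<in>{1..prosumers M i}. fst p i j)
      - (\<Sum>j\<in>{1..generators M i}. snd p i j))" for p
  define Box where "Box = {s. \<forall>i. s i \<in> {f. \<forall>j. f j \<in> Ks i j}}
      \<times> {y. \<forall>i. y i \<in> {f. \<forall>j. f j \<in> Ky i j}}"
  define K where "K = Box \<inter> {p. flow_feasible M (H p)}"
  have "compact Box"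
    unfolding Box_def by (intro compact_Times compact_Pi_UNIV) (auto simp: Ks_def Ky_def)
  moreover have "closed {p. flow_feasible M (H p)}"
  proof -
    have "continuous_on UNIV H"
      unfolding H_def by (intro continuous_intros continuous_on_coordinate2)
    from closed_vimage[OF closed_flow_feasible this] show ?thesis by (simp add: vimage_def)
  qed
  ultimately have "compact K" unfolding K_def by (rule compact_Int_closed)
  have emb: "(H (s, y), s, y) \<in> feasible_B M" if "(s, y) \<in> K" for s y
  proof -
    have "s i j \<in> Ks i j" "y i j \<in> Ky i j" for i j
      using that by (auto simp: K_def Box_def)
    hence "\<forall>i. \<forall>j\<in>{1..prosumers M i}. s i j \<in> {prosumer_capacity M i j - max_consumption M..
        prosumer_capacity M i j}" "\<forall>i. \<forall>j\<in>{1..generators M i}. y i j \<in> {y_min M i j..y_max M i j}"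
      unfolding Ks_def Ky_def by (metis (full_types))+
    thus ?thesis using that
      by (simp add: feasible_B_def generation_feasible_def K_def H_def)
  qed
  \<comment> \<open>The sums in the balance and in the welfare run over used indices only, so
    setting the other coordinates to 0 changes neither. Hence every feasible welfare value already
    occurs on \<open>K\<close>.\<close>
  have red: "\<exists>p\<in>K. welfare_B M (H p, p) = welfare_B M q" if q: "q \<in> feasible_B M" for q
  proof -
    obtain h s y where q_eq: "q = (h, s, y)" by (cases q)
    define p where "p = ((\<lambda>i j. if j \<in> {1..prosumers M i} then s i j else 0),
      (\<lambda>i j. if j \<in> {1..generators M i} then y i j else 0))"
    have "H p = h"
      using q by (simp add: H_def p_def q_eq feasible_B_def vec_eq_iff)
    hence "p \<in> K"
      using q by (auto simp: K_def Box_def p_def q_eq feasible_B_def generation_feasible_def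
          Ks_def Ky_def)
    moreover have "welfare_B M (H p, p) = welfare_B M q"
      by (simp add: p_def q_eq welfare_B.simps)
    ultimately show ?thesis by blast
  qed
  \<comment> \<open>Utilities are known to be continuous only on
    \<open>{0..max_consumption M}\<close>, so consumption must be shown to stay there on
    \<open>K\<close>; costs are treated likewise.\<close>
  have "continuous_on K (\<lambda>p. utility M i j (prosumer_capacity M i j - fst p i j))"
    if j: "j \<in> {1..prosumers M i}" for i j
  proof (rule continuous_on_compose2[where t = "{0..max_consumption M}" and g = "utility M i j"])
    show "continuous_on {0..max_consumption M} (utility M i j)"
      using M j unfolding market_assms_def utility_assms_def by blast
    show "continuous_on K (\<lambda>p. prosumer_capacity M i j - fst p i j)"
      by (intro continuous_intros continuous_on_coordinate2)
    have "fst p i j \<in> Ks i j" if "p \<in> K" for p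
      using that by (auto simp: K_def Box_def)
    thus "(\<lambda>p. prosumer_capacity M i j - fst p i j) ` K \<subseteq> {0..max_consumption M}"
      using j by (force simp: Ks_def)
  qed
  moreover have "continuous_on K (\<lambda>p. cost M i j (snd p i j))"
    if j: "j \<in> {1..generators M i}" for i j
  proof (rule continuous_on_compose2[where t = "{y_min M i j..y_max M i j}" and g = "cost M i j"])
    show "continuous_on {y_min M i j..y_max M i j} (cost M i j)"
      using M j unfolding market_assms_def cost_assms_def by blast
    show "continuous_on K (\<lambda>p. snd p i j)"
      by (intro continuous_intros continuous_on_coordinate2)
    have "snd p i j \<in> Ky i j" if "p \<in> K" for p
      using that by (auto simp: K_def Box_def)
    thus "(\<lambda>p. snd p i j) ` K \<subseteq> {y_min M i j..y_max M i j}"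
      using j by (force simp: Ky_def)
  qed
  ultimately have "continuous_on K (\<lambda>p. \<Sum>i\<in>UNIV.
     (\<Sum>j\<in>{1..prosumers M i}. utility M i j (prosumer_capacity M i j - fst p i j)) -
     (\<Sum>j\<in>{1..generators M i}. cost M i j (snd p i j)))"
    by (intro continuous_on_sum continuous_on_diff) auto
  hence "continuous_on K (\<lambda>p. welfare_B M (H p, p))"
    by (simp add: split_beta welfare_B_prod)
  moreover have "K \<noteq> {}" using ne red by blast
  ultimately obtain p where p: "p \<in> K" "\<And>q. q \<in> K \<Longrightarrow> welfare_B M (H q, q) \<le> welfare_B M (H p, p)"
    using continuous_attains_sup[OF \<open>compact K\<close>] by blast
  have "welfare_B M q \<le> welfare_B M (H p, p)" if "q \<in> feasible_B M" for q
    using red[OF that] p(2) by metis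
  moreover have "(H p, p) \<in> feasible_B M" using emb p(1) by (cases p) blast
  ultimately show ?thesis unfolding is_arg_max_iff by blast
qed

section \<open>Equality of optimal values and of optimal dispatches\<close>

text \<open>The existence conjunct, carried over to (B) by the equivalence, shows that both maxima
  are attained, so the suprema are genuine optimal values. The last conjunct adds uniqueness: any
  optimal dispatch of (A) and any of (B) agree at all used indices.\<close>

theorem theorem1:
  fixes M :: "('n::finite, 'm::finite) market"
  assumes "market_assms M"
    and "feasible_A M \<noteq> {}"
    and "feasible_B M \<noteq> {}"
  shows "opt_value_A M = opt_value_B M
    \<and> (\<exists>x d y. dispatch_A M x d y)
    \<and> (\<forall>x d y. dispatch_A M x d y \<longleftrightarrow> dispatch_B M x d y)
    \<and> (\<forall>x d y x' d' y'. dispatch_A M x d y \<longrightarrow> dispatch_B M x' d' y' \<longrightarrow>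
          same_dispatch M x d y x' d' y')"
proof (intro conjI allI impI)
  show "opt_value_A M = opt_value_B M"
    unfolding opt_value_A_def opt_value_B_def welfare_A_image_eq_welfare_B_image[OF assms(1)] ..
  obtain h s y where "is_arg_max (welfare_B M) (\<lambda>p. p \<in> feasible_B M) (h, s, y)"
    using arg_max_B_exists[OF assms(1,3)] by auto
  hence "dispatch_B M (\<lambda>i j. max (s i j) 0) (\<lambda>i j. max (- s i j) 0) y"
    unfolding dispatch_B_def by blast
  thus "\<exists>x d y. dispatch_A M x d y"
    using dispatch_A_iff_dispatch_B[OF assms(1)] by blast
  show "dispatch_A M x d y \<longleftrightarrow> dispatch_B M x d y" for x d y
    by (rule dispatch_A_iff_dispatch_B[OF assms(1)])
  show "same_dispatch M x d y x' d' y'" if A: "dispatch_A M x d y" and B: "dispatch_B M x' d' y'"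
    for x d y x' d' y'
  proof -
    \<comment> \<open>Both dispatches now come from optima of (B), whose net sales and outputs
      coincide; so do the positive and negative parts.\<close>
    have "dispatch_B M x d y" using A dispatch_A_iff_dispatch_B[OF assms(1)] by blast
    then obtain h s where opt: "is_arg_max (welfare_B M) (\<lambda>p. p \<in> feasible_B M) (h, s, y)"
      and parts: "\<forall>i. \<forall>j\<in>{1..prosumers M i}. x i j = max (s i j) 0 \<and> d i j = max (- s i j) 0"
      unfolding dispatch_B_def by blast
    obtain h' s' where opt': "is_arg_max (welfare_B M) (\<lambda>p. p \<in> feasible_B M) (h', s', y')"
      and parts': "\<forall>i. \<forall>j\<in>{1..prosumers M i}. x' i j = max (s' i j) 0 \<and> d' i j = max (- s' i j) 0"
      using B unfolding dispatch_B_def by blast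
    show ?thesis
      using arg_max_B_unique[OF assms(1) opt opt'] parts parts'
      unfolding same_dispatch_def by simp
  qed
qed

end
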